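(* For every real $\alpha\in(0,1)$, the quantity $\sup_{n\in\mathbb{N}}\dim\big(\mathcal{D}_{(\alpha n,n]}\big)$ is finite, and, as $\alpha\to0^+$, $$\sup_{n\in\mathbb{N}} \dim\big(\mathcal{D}_{(\alpha n,n]}\big) \;\le\; \tfrac{1}{\alpha}\big(\log(\tfrac1\alpha)\big)^{1+o(1)},$$ where $o(1)$ denotes a function of $\alpha$ tending to $0$ as $\alpha\to0^+$.
   Context: $\mathcal{D}_{(\alpha n,n]}$ denotes the set of integers $m$ with $\alpha n < m \le n$, partially ordered by divisibility ($a \le b$ iff $a\mid b$). A poset embedding $P \hookrightarrow Q$ is a map $\varphi$ with $\varphi(a)\le_Q\varphi(b)$ if and only if $a\le_P b$. The (Dushnik–Miller) dimension $\dim(P)$ of a countable poset $P$ is the minimum $d$ such that $P$ embeds into $\mathbb{R}^d$ with the coordinatewise order. $\log$ is the natural logarithm. *)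

theory Defs
  imports "HOL-Library.Extended_Real" "HOL-Library.FuncSet"
begin

(* Posets are given by a carrier and an order predicate, which is only used on the carrier. *)

definition poset_embedding ::
  "'a set \<Rightarrow> ('a \<Rightarrow> 'a \<Rightarrow> bool) \<Rightarrow> 'b set \<Rightarrow> ('b \<Rightarrow> 'b \<Rightarrow> bool) \<Rightarrow> ('a \<Rightarrow> 'b) \<Rightarrow> bool"
  where "poset_embedding P leP Q leQ \<phi> \<longleftrightarrow>
    \<phi> \<in> P \<rightarrow> Q \<and> (\<forall>a\<in>P. \<forall>b\<in>P. leQ (\<phi> a) (\<phi> b) \<longleftrightarrow> leP a b)"

(* The dimension d varies inside one statement, so points of R^d are functions on {..<d},
   made canonical by the value undefined elsewhere. *)

definition euclid_carrier :: "nat \<Rightarrow> (nat \<Rightarrow> real) set"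
  where "euclid_carrier d = {..<d} \<rightarrow>\<^sub>E UNIV"

definition coord_le :: "nat \<Rightarrow> (nat \<Rightarrow> real) \<Rightarrow> (nat \<Rightarrow> real) \<Rightarrow> bool"
  where "coord_le d x y \<longleftrightarrow> (\<forall>i<d. x i \<le> y i)"

(* The infimum is a minimum whenever some embedding exists, and is \<infinity> otherwise. *)

definition poset_dim :: "'a set \<Rightarrow> ('a \<Rightarrow> 'a \<Rightarrow> bool) \<Rightarrow> enat"
  where "poset_dim P le =
    Inf {enat d | d. \<exists>\<phi>. poset_embedding P le (euclid_carrier d) (coord_le d) \<phi>}"

(* For \<alpha> > 0 every integer in (\<alpha> n, n] is positive, so nat suffices. *)

definition div_interval :: "real \<Rightarrow> nat \<Rightarrow> nat set"
  where "div_interval \<alpha> n = {m. \<alpha> * real n < real m \<and> m \<le> n}"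

definition sup_dim :: "real \<Rightarrow> enat"
  where "sup_dim \<alpha> = (SUP n. poset_dim (div_interval \<alpha> n) (dvd))"

end

theory Submission
  imports Defs "HOL-Computational_Algebra.Primes" "HOL-Real_Asymp.Real_Asymp"
begin

text \<open>
  If \<open>a\<close> divides \<open>b\<close> and both lie in \<open>(\<alpha>n, n]\<close>, then \<open>b / a < 1/\<alpha>\<close>, so \<open>a\<close> and \<open>b\<close> can differ only at
  primes below \<open>1/\<alpha>\<close>. Put \<open>K = \<lceil>1/\<alpha>\<rceil>\<close> and let the rough part of \<open>m\<close> collect the prime powers of
  \<open>m\<close> at primes \<open>p \<ge> K\<close>. Divisibility on the interval then says exactly that the rough parts are
  equal and that the \<open>p\<close>-adic valuations at the primes \<open>p < K\<close> are ordered
  (\<open>dvd_iff_rough_part\<close>). Equality of the rough parts is two inequalities, one between the rough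
  parts and one between their negatives, so \<open>K + 2\<close> coordinates suffice, whatever \<open>n\<close> is.

  The resulting bound \<open>1/\<alpha> + 3\<close> on the supremum is linear in \<open>1/\<alpha>\<close> and hence eventually below
  \<open>(1/\<alpha>) log (1/\<alpha>)\<close>, so the exponent can be taken with error term identically \<open>0\<close>.
\<close>

definition rough_part :: "nat \<Rightarrow> nat \<Rightarrow> nat"
  where "rough_part K m = prod_mset (filter_mset (\<lambda>p. K \<le> p) (prime_factorization m))"

lemma prime_factorization_rough_part:
  "prime_factorization (rough_part K m) = filter_mset (\<lambda>p. K \<le> p) (prime_factorization m)"
  unfolding rough_part_def by (rule prime_factorization_prod_mset_primes) auto

lemma rough_part_mult_small:
  assumes "a > 0" "c > 0" "c < K"
  shows "rough_part K (a * c) = rough_part K a"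
proof -
  have "p < K" if "p \<in># prime_factorization c" for p
    using that assms by (metis in_prime_factors_imp_dvd dvd_imp_le le_less_trans)
  then have no_large: "filter_mset (\<lambda>p. K \<le> p) (prime_factorization c) = {#}"
    by (auto simp: filter_mset_eq_conv not_le)
  then show ?thesis
    using assms by (simp add: rough_part_def prime_factorization_mult no_large)
qed

text \<open>
  Forwards, the ratio hypothesis keeps the cofactor \<open>b / a\<close> free of primes \<open>p \<ge> K\<close>. Backwards,
  the rough part determines all valuations at primes \<open>p \<ge> K\<close> by unique factorization.
\<close>

lemma dvd_iff_rough_part:
  assumes "a > 0" "b > 0" "b < K * a"
  shows "a dvd b \<longleftrightarrow>
    (\<forall>p<K. prime p \<longrightarrow> multiplicity p a \<le> multiplicity p b) \<and> rough_part K a = rough_part K b"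
proof
  assume "a dvd b"
  then obtain c where c: "b = a * c" ..
  then have "c > 0" "c < K" using assms by (auto simp: mult.commute)
  then show "(\<forall>p<K. prime p \<longrightarrow> multiplicity p a \<le> multiplicity p b) \<and>
      rough_part K a = rough_part K b"
    using \<open>a dvd b\<close> assms c by (auto simp: rough_part_mult_small intro: dvd_imp_multiplicity_le)
next
  assume R: "(\<forall>p<K. prime p \<longrightarrow> multiplicity p a \<le> multiplicity p b) \<and>
      rough_part K a = rough_part K b"
  have "multiplicity p a \<le> multiplicity p b" if "prime p" for p
  proof (cases "p < K")
    case False
    have "count (prime_factorization (rough_part K a)) p =
        count (prime_factorization (rough_part K b)) p"
      using R by simp
    then show ?thesis
      using False that by (simp add: prime_factorization_rough_part count_prime_factorization_prime)
  qed (use R that in simp)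
  then show "a dvd b"
    using assms by (intro multiplicity_le_imp_dvd) auto
qed

lemma poset_dim_div_interval_le:
  assumes "0 < \<alpha>" "1 / \<alpha> \<le> real K"
  shows "poset_dim (div_interval \<alpha> n) (dvd) \<le> enat (K + 2)"
proof -
  define \<phi> :: "nat \<Rightarrow> nat \<Rightarrow> real" where
    "\<phi> m = (\<lambda>i\<in>{..<K + 2}.
        if i < K then (if prime i then real (multiplicity i m) else 0)
        else if i = K then real (rough_part K m)
        else - real (rough_part K m))" for m
  have "coord_le (K + 2) (\<phi> a) (\<phi> b) \<longleftrightarrow> a dvd b"
    if "a \<in> div_interval \<alpha> n" "b \<in> div_interval \<alpha> n" for a b
  proof -
    have ab: "\<alpha> * real n < real a" "\<alpha> * real n < real b" "b \<le> n"
      using that by (auto simp: div_interval_def)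
    have "0 \<le> \<alpha> * real n" using assms by simp
    then have pos: "a > 0" "b > 0" using ab by linarith+
    have "real b \<le> real n" using ab by simp
    also have "\<dots> < 1 / \<alpha> * real a" using ab assms by (simp add: field_simps)
    also have "\<dots> \<le> real K * real a" using assms by (intro mult_right_mono) auto
    finally have "b < K * a" by (simp flip: of_nat_mult)
    have "coord_le (K + 2) (\<phi> a) (\<phi> b) \<longleftrightarrow>
        (\<forall>i<K. \<phi> a i \<le> \<phi> b i) \<and> \<phi> a K \<le> \<phi> b K \<and> \<phi> a (Suc K) \<le> \<phi> b (Suc K)"
      by (auto simp: coord_le_def less_Suc_eq)
    also have "\<dots> \<longleftrightarrow> (\<forall>p<K. prime p \<longrightarrow> multiplicity p a \<le> multiplicity p b) \<and>
        rough_part K a = rough_part K b"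
      by (auto simp: \<phi>_def)
    finally show ?thesis
      using dvd_iff_rough_part[OF pos \<open>b < K * a\<close>] by simp
  qed
  then have "poset_embedding (div_interval \<alpha> n) (dvd) (euclid_carrier (K + 2)) (coord_le (K + 2)) \<phi>"
    by (auto simp: poset_embedding_def euclid_carrier_def \<phi>_def)
  then show ?thesis
    unfolding poset_dim_def by (intro Inf_lower) auto
qed

lemma sup_dim_le:
  assumes "0 < \<alpha>"
  shows "sup_dim \<alpha> \<le> enat (nat \<lceil>1 / \<alpha>\<rceil> + 2)"
  unfolding sup_dim_def
  using assms by (intro SUP_least poset_dim_div_interval_le) (auto intro: real_nat_ceiling_ge)

theorem mainTheorem5:
  shows "(\<forall>\<alpha>::real. 0 < \<alpha> \<and> \<alpha> < 1 \<longrightarrow> sup_dim \<alpha> < \<infinity>) \<and>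
    (\<exists>\<epsilon> :: real \<Rightarrow> real. (\<epsilon> \<longlongrightarrow> 0) (at_right 0) \<and>
      (\<forall>\<^sub>F \<alpha> in at_right 0.
        ereal_of_enat (sup_dim \<alpha>) \<le> ereal (1 / \<alpha> * ln (1 / \<alpha>) powr (1 + \<epsilon> \<alpha>))))"
proof (intro conjI allI impI)
  fix \<alpha> :: real
  assume "0 < \<alpha> \<and> \<alpha> < 1"
  then show "sup_dim \<alpha> < \<infinity>"
    using sup_dim_le[of \<alpha>] by (metis enat_ord_simps(4) infinity_ileE le_less_trans)
next
  have "\<forall>\<^sub>F \<alpha> in at_right (0::real). 1 / \<alpha> + 3 \<le> 1 / \<alpha> * ln (1 / \<alpha>) powr 1"
    by real_asymp
  moreover have "\<forall>\<^sub>F \<alpha> in at_right (0::real). 0 < \<alpha>"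
    by (rule eventually_at_right_less)
  ultimately have "\<forall>\<^sub>F \<alpha> in at_right 0.
      ereal_of_enat (sup_dim \<alpha>) \<le> ereal (1 / \<alpha> * ln (1 / \<alpha>) powr (1 + 0))"
  proof eventually_elim
    case (elim \<alpha>)
    have "ereal_of_enat (sup_dim \<alpha>) \<le> ereal_of_enat (enat (nat \<lceil>1 / \<alpha>\<rceil> + 2))"
      using sup_dim_le[OF elim(2)] by (simp only: ereal_of_enat_le_iff)
    also have "\<dots> = ereal (real (nat \<lceil>1 / \<alpha>\<rceil>) + 2)" by simp
    also have "real (nat \<lceil>1 / \<alpha>\<rceil>) + 2 \<le> 1 / \<alpha> + 3"
    proof -
      have "real (nat \<lceil>1 / \<alpha>\<rceil>) = of_int \<lceil>1 / \<alpha>\<rceil>"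
        using elim(2) by simp
      then show ?thesis by linarith
    qed
    also have "\<dots> \<le> 1 / \<alpha> * ln (1 / \<alpha>) powr (1 + 0)"
      using elim(1) by simp
    finally show ?case by simp
  qed
  then show "\<exists>\<epsilon> :: real \<Rightarrow> real. (\<epsilon> \<longlongrightarrow> 0) (at_right 0) \<and>
      (\<forall>\<^sub>F \<alpha> in at_right 0.
        ereal_of_enat (sup_dim \<alpha>) \<le> ereal (1 / \<alpha> * ln (1 / \<alpha>) powr (1 + \<epsilon> \<alpha>)))"
    by (intro exI[of _ "\<lambda>_. 0"]) auto
qed

end
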